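(* Fix a natural number $d\ge 3$. For every $n\ge 3$, let $c=c_{n-1}$ and let $z_i=f_c^{\,i-1}(0)$ for $1\le i\le n$, so that $\{z_1=0,\, z_2=1,\, z_3,\dots,z_n=c\}$ is an $n$-cycle of $f_c$. Then $$z_1 = 0 < z_n < \dots < z_{i+1} < z_i < \dots < z_3 < 1 = z_2 .$$
   Context: For real $c\neq 0$ let $$f_c(x)=\frac{(d-1)c^d-(d-1)x^d}{(d-1)c^d-dx^{d-1}},$$ which is the Newton map $x-p_c(x)/p_c'(x)$ of $p_c(x)=x^d-(d-1)c^dx+(d-1)c^d$; $f_c^{\,k}$ denotes its $k$-th iterate ($f_c^{\,0}$ is the identity). Define real rational functions $Q_k$ of a real variable $c$ by $Q_1\equiv 1$ and $$Q_{i+1}(c)=\frac{c^d-Q_i(c)^d}{c^d-\left(\frac{d}{d-1}\right)Q_i(c)^{d-1}},\qquad i\ge 1$$ (so that $Q_k(c)=f_c^{\,k}(0)$ for $c\ne 0$, and $Q_k(0)=\left(\frac{d-1}{d}\right)^{k-1}$). For $k\ge 1$, $c_k$ denotes the smallest positive solution $y$ of $y^d-Q_k(y)^d=0$ (it exists). *)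

theory Defs
  imports Complex_Main "HOL-Computational_Algebra.Polynomial_Factorial"
begin

definition newton_den :: "nat \<Rightarrow> real \<Rightarrow> real \<Rightarrow> real" where
  "newton_den d c x = (real d - 1) * c ^ d - real d * x ^ (d - 1)"

(* The Newton map x - p(x) / p'(x) of p(x) = x^d - (d-1) c^d x + (d-1) c^d.  Where newton_den
   vanishes, the value 0 is an artefact of division by zero. *)
definition newton_map :: "nat \<Rightarrow> real \<Rightarrow> real \<Rightarrow> real" where
  "newton_map d c x =
     ((real d - 1) * c ^ d - (real d - 1) * x ^ d) / newton_den d c x"

abbreviation ratX :: "real poly fract" where
  "ratX \<equiv> to_fract [:0, 1:]"

abbreviation rat_const :: "real \<Rightarrow> real poly fract" where
  "rat_const a \<equiv> to_fract [:a:]"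

(* The family starts at index 1; the value at index 0 is a placeholder and is never used. *)
fun Q :: "nat \<Rightarrow> nat \<Rightarrow> real poly fract" where
  "Q d 0 = 0"
| "Q d (Suc 0) = 1"
| "Q d (Suc (Suc i)) =
     (ratX ^ d - Q d (Suc i) ^ d) /
     (ratX ^ d - rat_const (real d / (real d - 1)) * Q d (Suc i) ^ (d - 1))"

(* Evaluation of a rational function: q is defined at y, with value v.  The condition
   poly b y \<noteq> 0 makes v unique and excludes exactly the poles of q. *)
definition has_value_at :: "real poly fract \<Rightarrow> real \<Rightarrow> real \<Rightarrow> bool" where
  "has_value_at q y v \<longleftrightarrow>
     (\<exists>a b. q = Fract a b \<and> poly b y \<noteq> 0 \<and> v = poly a y / poly b y)"

definition c_sol :: "nat \<Rightarrow> nat \<Rightarrow> real" where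
  "c_sol d k = (LEAST y. 0 < y \<and> (\<exists>v. has_value_at (Q d k) y v \<and> y ^ d - v ^ d = 0))"

end

theory Submission
  imports Defs
begin

text \<open>
  For \<open>0 < c \<le> 1\<close> the polynomial \<open>p\<close> whose Newton map is \<^term>\<open>newton_map d c\<close> is positive on the
  positive axis and its only critical point there lies to the left of \<open>c\<close>
  (\<open>newton_den_neg\<close>). On \<open>[c, \<infinity>)\<close> the Newton map therefore has no pole, moves every
  point strictly to the left (\<open>newton_map_less\<close>), is positive beyond \<open>c\<close>
  (\<open>newton_map_pos\<close>), and vanishes at \<open>c\<close>. An orbit that starts at \<open>1\<close> hence
  decreases for as long as it stays in \<open>[c, \<infinity>)\<close>, and if it lands exactly on \<open>c\<close>, it
  continues to \<open>0\<close> and from there back to \<open>1\<close>.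

  What has to be shown is that for \<open>c = c_sol d (k + 1)\<close> the orbit of \<open>1\<close> stays above \<open>c\<close> and
  hits it after \<open>k\<close> steps. This is an induction on \<open>k\<close> with the step \<open>first_hit_Suc\<close>. Suppose that
  \<open>a\<close> is the first parameter at which the orbit of \<open>1\<close> hits its parameter after \<open>k\<close> steps. As the
  parameter \<open>y\<close> runs through \<open>[0, a]\<close>, the next orbit point is a continuous function of \<open>y\<close>, which is
  positive at \<open>y = 0\<close> and has the value \<open>0\<close> at \<open>y = a\<close>. So its graph meets the diagonal
  strictly between, and the first meeting point is the next hitting parameter. These parameters thus
  decrease, and at each of them the earlier orbit points still lie above the parameter.

  On the positive parameters up to the first hitting one, the rational function \<^term>\<open>Q d (Suc k)\<close> has no pole and its
  value is the orbit point (\<open>Q_has_value\<close>), which before the hit exceeds the parameter and in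
  particular is positive; so \<open>y ^ d = v ^ d\<close> has no smaller solution, not even one with \<open>v = - y\<close>, and
  the first hitting parameter is \<^term>\<open>c_sol d (Suc k)\<close> (\<open>c_sol_eq_first_hit\<close>).
\<close>

section \<open>Evaluation of rational functions\<close>

lemma has_value_at_unique:
  assumes "has_value_at q y v" and "has_value_at q y w"
  shows "v = w"
proof -
  obtain a b where ab: "q = Fract a b" "poly b y \<noteq> 0" "v = poly a y / poly b y"
    using assms(1) by (auto simp: has_value_at_def)
  obtain a' b' where ab': "q = Fract a' b'" "poly b' y \<noteq> 0" "w = poly a' y / poly b' y"
    using assms(2) by (auto simp: has_value_at_def)
  have "b \<noteq> 0" "b' \<noteq> 0" using ab ab' by auto
  then have "a * b' = a' * b" using ab(1) ab'(1) by (simp add: eq_fract)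
  then have "poly a y * poly b' y = poly a' y * poly b y" by (metis poly_mult)
  then show ?thesis unfolding ab(3) ab'(3) using ab(2) ab'(2) by (simp add: frac_eq_eq)
qed

lemma has_value_at_to_fract: "has_value_at (to_fract p) y (poly p y)"
  unfolding has_value_at_def to_fract_def by (intro exI[of _ p] exI[of _ 1]) simp

lemma has_value_at_ratX: "has_value_at ratX y y"
  using has_value_at_to_fract[of "[:0, 1:]" y] by simp

lemma has_value_at_rat_const: "has_value_at (rat_const a) y a"
  using has_value_at_to_fract[of "[:a:]" y] by simp

lemma has_value_at_one: "has_value_at 1 y 1"
  using has_value_at_to_fract[of 1 y] by simp

lemma has_value_at_mult:
  assumes "has_value_at q y v" and "has_value_at r y w"
  shows "has_value_at (q * r) y (v * w)"
proof -
  obtain a b where ab: "q = Fract a b" "poly b y \<noteq> 0" "v = poly a y / poly b y"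
    using assms(1) by (auto simp: has_value_at_def)
  obtain a' b' where ab': "r = Fract a' b'" "poly b' y \<noteq> 0" "w = poly a' y / poly b' y"
    using assms(2) by (auto simp: has_value_at_def)
  show ?thesis unfolding has_value_at_def
    by (intro exI[of _ "a * a'"] exI[of _ "b * b'"]) (use ab ab' in simp)
qed

lemma has_value_at_power:
  assumes "has_value_at q y v"
  shows "has_value_at (q ^ n) y (v ^ n)"
  by (induction n) (auto intro: has_value_at_one has_value_at_mult assms)

lemma has_value_at_diff:
  assumes "has_value_at q y v" and "has_value_at r y w"
  shows "has_value_at (q - r) y (v - w)"
proof -
  obtain a b where ab: "q = Fract a b" "poly b y \<noteq> 0" "v = poly a y / poly b y"
    using assms(1) by (auto simp: has_value_at_def)
  obtain a' b' where ab': "r = Fract a' b'" "poly b' y \<noteq> 0" "w = poly a' y / poly b' y"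
    using assms(2) by (auto simp: has_value_at_def)
  have "b \<noteq> 0" "b' \<noteq> 0" using ab ab' by auto
  then show ?thesis unfolding has_value_at_def
    by (intro exI[of _ "a * b' - a' * b"] exI[of _ "b * b'"])
      (use ab ab' in \<open>simp add: diff_frac_eq\<close>)
qed

lemma has_value_at_divide:
  assumes "has_value_at q y v" and "has_value_at r y w" and "w \<noteq> 0"
  shows "has_value_at (q / r) y (v / w)"
proof -
  obtain a b where ab: "q = Fract a b" "poly b y \<noteq> 0" "v = poly a y / poly b y"
    using assms(1) by (auto simp: has_value_at_def)
  obtain a' b' where ab': "r = Fract a' b'" "poly b' y \<noteq> 0" "w = poly a' y / poly b' y"
    using assms(2) by (auto simp: has_value_at_def)
  have "poly a' y \<noteq> 0" using ab'(3) assms(3) by auto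
  then show ?thesis unfolding has_value_at_def
    by (intro exI[of _ "a * b'"] exI[of _ "b * a'"]) (use ab ab' in simp)
qed

section \<open>The Newton map to the right of its parameter\<close>

lemma newton_den_neg:
  assumes "d \<ge> 2" "0 \<le> c" "c \<le> 1" "c \<le> x" "0 < x"
  shows "newton_den d c x < 0"
proof -
  have "(real d - 1) * c ^ d \<le> (real d - 1) * c ^ (d - 1)"
    using assms by (intro mult_left_mono power_decreasing) auto
  also have "\<dots> \<le> (real d - 1) * x ^ (d - 1)"
    using assms by (intro mult_left_mono power_mono) auto
  also have "\<dots> < real d * x ^ (d - 1)"
    using assms by (intro mult_strict_right_mono) auto
  finally show ?thesis by (simp add: newton_den_def)
qed

text \<open>
  The Newton step is \<open>p x / p' x\<close> with \<open>p' x = - newton_den d c x > 0\<close>, so the claim is the positivity of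
  \<open>p x = x ^ d - (d - 1) c ^ d (x - 1)\<close>. For \<open>x \<le> 1\<close> no term is negative; for
  \<open>x > 1\<close> the bound \<open>c \<le> 1\<close> reduces it to Bernoulli's inequality.
\<close>
lemma newton_map_less:
  assumes "d \<ge> 2" "0 \<le> c" "c \<le> 1" "c \<le> x" "0 < x"
  shows "newton_map d c x < x"
proof -
  have "(real d - 1) * c ^ d * (x - 1) < x ^ d"
  proof (cases "x \<le> 1")
    case True
    then have "(real d - 1) * c ^ d * (x - 1) \<le> 0"
      using assms by (intro mult_nonneg_nonpos) auto
    also have "0 < x ^ d" using assms by simp
    finally show ?thesis .
  next
    case False
    have "c ^ d \<le> 1" using assms by (simp add: power_le_one)
    then have "(real d - 1) * c ^ d * (x - 1) \<le> (real d - 1) * 1 * (x - 1)"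
      using assms False by (intro mult_right_mono mult_left_mono) auto
    also have "\<dots> < 1 + real d * (x - 1)" using False by (simp add: algebra_simps)
    also have "\<dots> \<le> x ^ d"
      using Bernoulli_inequality[of "x - 1" d] assms by simp
    finally show ?thesis .
  qed
  moreover have "x ^ d = x * x ^ (d - 1)"
    using assms(1) by (cases d) auto
  ultimately have "x * newton_den d c x < (real d - 1) * c ^ d - (real d - 1) * x ^ d"
    by (simp add: newton_den_def algebra_simps)
  then show ?thesis
    using newton_den_neg[OF assms] by (simp add: newton_map_def neg_divide_less_eq)
qed

lemma newton_map_pos:
  assumes "d \<ge> 2" "0 \<le> c" "c \<le> 1" "c < x"
  shows "0 < newton_map d c x"
proof -
  have "c ^ d < x ^ d" using assms by (intro power_strict_mono) auto
  then have "(real d - 1) * c ^ d - (real d - 1) * x ^ d < 0"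
    using assms by simp
  then show ?thesis
    using newton_den_neg[of d c x] assms by (simp add: newton_map_def divide_neg_neg)
qed

lemma newton_map_self: "newton_map d c c = 0"
  by (simp add: newton_map_def)

lemma newton_map_zero:
  assumes "d \<ge> 2" "c \<noteq> 0"
  shows "newton_map d c 0 = 1"
  using assms by (simp add: newton_map_def newton_den_def zero_power)

section \<open>The first parameter at which the orbit hits the parameter\<close>

text \<open>
  The parameter \<open>0\<close> belongs to the intervals although it has no cycle: there the Newton map is
  multiplication by \<open>(d - 1) / d\<close>, so the orbit of \<open>1\<close> is positive. This is the left end of the
  intermediate value argument that finds the next hit. The clause about \<open>j < k\<close> keeps the
  earlier orbit points off the diagonal at \<open>a\<close> itself.
\<close>
definition first_hit :: "nat \<Rightarrow> nat \<Rightarrow> real \<Rightarrow> bool" where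
  "first_hit d k a \<longleftrightarrow> 0 < a \<and> a \<le> 1 \<and>
     (newton_map d a ^^ k) 1 = a \<and> (\<forall>j<k. a < (newton_map d a ^^ j) 1) \<and>
     (\<forall>y\<in>{0..<a}. \<forall>j\<le>k. y < (newton_map d y ^^ j) 1) \<and>
     continuous_on {0..a} (\<lambda>y. (newton_map d y ^^ k) 1)"

lemma first_hit_0: "first_hit d 0 1"
  by (simp add: first_hit_def)

text \<open>
  At \<open>a\<close> the orbit point after \<open>k\<close> steps is \<open>a\<close>, which the Newton map sends to \<open>0\<close>; so the next
  orbit point, positive at the parameter \<open>0\<close>, has fallen below the diagonal at \<open>a\<close>. The least
  crossing \<open>b\<close> is the new hit. Since \<open>b < a\<close>, all that is known below \<open>a\<close> about the first \<open>k\<close>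
  steps holds at \<open>b\<close> itself.
\<close>
lemma first_hit_Suc:
  assumes d: "d \<ge> 2" and a: "first_hit d k a"
  shows "\<exists>b<a. first_hit d (Suc k) b"
proof -
  define F where "F j y = (newton_map d y ^^ j) 1" for j y
  have a01: "0 < a" "a \<le> 1" and Fa: "F k a = a"
    and below: "\<And>y j. 0 \<le> y \<Longrightarrow> y < a \<Longrightarrow> j \<le> k \<Longrightarrow> y < F j y"
    and cont: "continuous_on {0..a} (F k)"
    using a by (auto simp: first_hit_def F_def)
  have FS: "F (Suc k) y = newton_map d y (F k y)" for y
    by (simp add: F_def)
  have ge: "y \<le> F k y" "0 < F k y" if "y \<in> {0..a}" for y
    using below[of y k] Fa a01 that by (cases "y = a"; force)+
  have den: "newton_den d y (F k y) < 0" if "y \<in> {0..a}" for y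
    using newton_den_neg[of d y "F k y"] ge[OF that] that d a01 by auto
  have contS: "continuous_on {0..a} (F (Suc k))"
    unfolding FS newton_map_def
  proof (intro continuous_on_divide)
    show "continuous_on {0..a} (\<lambda>y. (real d - 1) * y ^ d - (real d - 1) * F k y ^ d)"
      by (intro continuous_intros cont)
    show "continuous_on {0..a} (\<lambda>y. newton_den d y (F k y))"
      unfolding newton_den_def by (intro continuous_intros cont)
    show "\<forall>y\<in>{0..a}. newton_den d y (F k y) \<noteq> 0" using den by force
  qed
  define g where "g y = F (Suc k) y - y" for y
  have contg: "continuous_on {0..a} g"
    unfolding g_def by (intro continuous_intros contS)
  have g0: "0 < g 0"
    using newton_map_pos[of d 0 "F k 0"] ge[of 0] d a01 by (simp add: g_def FS)
  have ga: "g a < 0"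
    using a01 by (simp add: g_def FS Fa newton_map_self)
  define S where "S = {y\<in>{0..a}. g y = 0}"
  have "compact S"
  proof -
    have "S = {0..a} \<inter> (g -` {0} \<inter> {0..a})" by (auto simp: S_def)
    moreover have "closed (g -` {0} \<inter> {0..a})"
      by (rule closed_vimage_Int[OF _ contg]) auto
    ultimately show ?thesis using compact_Int_closed[OF compact_Icc] by metis
  qed
  moreover have "S \<noteq> {}"
  proof -
    have "\<exists>y\<ge>0. y \<le> a \<and> g y = 0"
      using IVT2'[of g a 0 0] g0 ga a01 contg by auto
    then show ?thesis by (auto simp: S_def)
  qed
  ultimately obtain b where bS: "b \<in> S" and bmin: "\<And>y. y \<in> S \<Longrightarrow> b \<le> y"
    using compact_attains_inf[of S] by blast
  have b: "0 < b" "b < a" and gb: "g b = 0"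
    using bS g0 ga by (auto simp: S_def order_less_le)
  have gpos: "0 < g y" if y: "0 \<le> y" "y < b" for y
  proof (rule ccontr)
    assume "\<not> 0 < g y"
    moreover have "continuous_on {0..y} g"
      by (rule continuous_on_subset[OF contg]) (use y b in auto)
    ultimately obtain x where "0 \<le> x" "x \<le> y" "g x = 0"
      using IVT2'[of g y 0 0] g0 y by auto
    then show False using bmin[of x] y b by (auto simp: S_def)
  qed
  have "first_hit d (Suc k) b"
    unfolding first_hit_def F_def[symmetric]
  proof (intro conjI ballI allI impI)
    show "b < F j b" if "j < Suc k" for j
      using below[of b j] b that by auto
    show "y < F j y" if "y \<in> {0..<b}" "j \<le> Suc k" for y j
      using below[of y j] gpos[of y] b that by (cases "j = Suc k") (auto simp: g_def)
    show "continuous_on {0..b} (F (Suc k))"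
      by (rule continuous_on_subset[OF contS]) (use b in auto)
    show "0 < b" "b \<le> 1" "F (Suc k) b = b" using b a01 gb by (simp_all add: g_def)
  qed
  with b show ?thesis by blast
qed

lemma first_hit_exists:
  assumes "d \<ge> 2"
  shows "\<exists>a. first_hit d k a \<and> (0 < k \<longrightarrow> a < 1)"
proof (induction k)
  case 0
  show ?case using first_hit_0 by auto
next
  case (Suc k)
  then obtain a where a: "first_hit d k a" by blast
  then have "a \<le> 1" by (simp add: first_hit_def)
  then show ?case using first_hit_Suc[OF assms a] by force
qed

section \<open>The parameters \<open>c_sol\<close>\<close>

text \<open>
  Each step of the recursion for \<open>Q\<close> is a Newton step after cancelling \<open>d - 1\<close>, and its
  denominator is nonzero because the orbit has not yet dropped below \<open>y\<close>.
\<close>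
lemma Q_has_value:
  assumes d: "d \<ge> 2" and y: "0 < y" "y \<le> 1"
    and above: "\<And>j. j < k \<Longrightarrow> y \<le> (newton_map d y ^^ j) 1"
  shows "has_value_at (Q d (Suc k)) y ((newton_map d y ^^ k) 1)"
  using above
proof (induction k)
  case 0
  show ?case by (simp add: has_value_at_one)
next
  case (Suc k)
  define x where "x = (newton_map d y ^^ k) 1"
  have IH: "has_value_at (Q d (Suc k)) y x"
    using Suc by (simp add: x_def)
  have "y \<le> x" using Suc.prems[of k] by (simp add: x_def)
  then have neg: "newton_den d y x < 0"
    using newton_den_neg[of d y x] d y by simp
  define D where "D = y ^ d - real d / (real d - 1) * x ^ (d - 1)"
  have d1: "real d - 1 > 0" using d by simp
  have den: "newton_den d y x = (real d - 1) * D"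
    using d1 by (simp add: newton_den_def D_def right_diff_distrib)
  have "D \<noteq> 0" using neg den by auto
  then have "has_value_at (Q d (Suc (Suc k))) y ((y ^ d - x ^ d) / D)"
    unfolding Q.simps D_def
    by (intro has_value_at_divide has_value_at_diff has_value_at_mult has_value_at_power
        has_value_at_ratX has_value_at_rat_const IH)
  moreover have "newton_map d y x = (y ^ d - x ^ d) / D"
    using d1 by (simp add: newton_map_def den right_diff_distrib[symmetric])
  ultimately show ?case by (simp add: x_def)
qed

lemma c_sol_eq_first_hit:
  assumes d: "d \<ge> 2" and a: "first_hit d k a"
  shows "c_sol d (Suc k) = a"
  unfolding c_sol_def
proof (rule Least_equality)
  let ?F = "\<lambda>j y. (newton_map d y ^^ j) 1"
  have a01: "0 < a" "a \<le> 1" and Fa: "?F k a = a"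
    and above: "\<And>j. j < k \<Longrightarrow> a < ?F j a"
    and below: "\<And>y j. 0 \<le> y \<Longrightarrow> y < a \<Longrightarrow> j \<le> k \<Longrightarrow> y < ?F j y"
    using a by (auto simp: first_hit_def)
  have "has_value_at (Q d (Suc k)) a a"
    using Q_has_value[of d a k] d a01 above Fa by (force simp: less_imp_le)
  then show "0 < a \<and> (\<exists>v. has_value_at (Q d (Suc k)) a v \<and> a ^ d - v ^ d = 0)"
    using a01 by force
  fix y assume "0 < y \<and> (\<exists>v. has_value_at (Q d (Suc k)) y v \<and> y ^ d - v ^ d = 0)"
  then obtain v where y: "0 < y" and v: "has_value_at (Q d (Suc k)) y v" "y ^ d = v ^ d"
    by auto
  show "a \<le> y"
  proof (rule ccontr)
    assume "\<not> a \<le> y"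
    then have ya: "y < a" by simp
    have "has_value_at (Q d (Suc k)) y (?F k y)"
      using Q_has_value[of d y k] d a01 y ya below[of y] by (simp add: less_imp_le)
    then have "v = ?F k y" using v has_value_at_unique by blast
    then have "y < v" using below[of y k] y ya by simp
    then have "y ^ d < v ^ d" using y d by (intro power_strict_mono) auto
    then show False using v by simp
  qed
qed

section \<open>The cycle\<close>

theorem proposition4p1:
  fixes d n :: nat and c :: real and z :: "nat \<Rightarrow> real"
  assumes "d \<ge> 3" and "n \<ge> 3"
    and "c = c_sol d (n - 1)"
    and "\<And>i. 1 \<le> i \<Longrightarrow> i \<le> n \<Longrightarrow> z i = (newton_map d c ^^ (i - 1)) 0"
  shows "((\<forall>i\<in>{1..n}. newton_den d c (z i) \<noteq> 0) \<and> inj_on z {1..n} \<and>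
          newton_map d c (z n) = z 1 \<and> z n = c) \<and>
         (z 1 = 0 \<and> 0 < z n \<and> (\<forall>i. 3 \<le> i \<and> i < n \<longrightarrow> z (i + 1) < z i) \<and>
          z 3 < 1 \<and> 1 = z 2)"
proof -
  have d: "d \<ge> 2" using assms(1) by simp
  define k where "k = n - 2"
  have k: "0 < k" "n = k + 2" "n - 1 = Suc k" using assms(2) by (auto simp: k_def)
  obtain a where a: "first_hit d k a" "a < 1"
    using first_hit_exists[OF d, of k] k by auto
  have "c = a" using c_sol_eq_first_hit[OF d a(1)] assms(3) k by simp
  then have hit: "first_hit d k c" and c1: "c < 1" using a by auto
  have c0: "0 < c" and last: "(newton_map d c ^^ k) 1 = c"
    and above: "\<And>j. j < k \<Longrightarrow> c < (newton_map d c ^^ j) 1"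
    using hit by (auto simp: first_hit_def)
  have z1: "z 1 = 0" using assms(4)[of 1] k by simp
  have zj: "z (j + 2) = (newton_map d c ^^ j) 1" if "j \<le> k" for j
  proof -
    have "z (j + 2) = (newton_map d c ^^ Suc j) 0" using assms(4)[of "j + 2"] k that by simp
    also have "\<dots> = (newton_map d c ^^ j) 1"
      using newton_map_zero[of d c] d c0 by (simp add: funpow_swap1)
    finally show ?thesis .
  qed
  have zn: "z n = c" using zj[of k] last k by simp
  have z_ge: "c \<le> z i" if "2 \<le> i" "i \<le> n" for i
  proof (cases "i = n")
    case True then show ?thesis using zj[of k] last k by simp
  next
    case False
    then have "i - 2 < k" "i - 2 + 2 = i" using that k by auto
    then show ?thesis using zj[of "i - 2"] above[of "i - 2"] by simp
  qed
  have z_step: "z (Suc i) < z i" if "2 \<le> i" "i < n" for i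
  proof -
    have "z (Suc i) = newton_map d c (z i)"
      using assms(4)[of i] assms(4)[of "Suc i"] that by (cases i) auto
    then show ?thesis
      using newton_map_less[of d c "z i"] z_ge[of i] that d c0 c1 by auto
  qed
  have z_anti: "z j < z i" if "i < j" "2 \<le> i" "j \<le> n" for i j
    using that
  proof (induction j rule: less_Suc_induct)
    case (1 i) then show ?case using z_step by simp
  next
    case (2 i j k) then show ?case by fastforce
  qed
  have z_ne: "z i \<noteq> z j" if "1 \<le> i" "i < j" "j \<le> n" for i j
  proof (cases "i = 1")
    case True then show ?thesis using z1 z_ge[of j] c0 that by simp
  next
    case False then show ?thesis using z_anti[of i j] that by simp
  qed
  have "inj_on z {1..n}"
    by (rule linorder_inj_onI') (use z_ne in auto)
  moreover have "newton_den d c (z i) \<noteq> 0" if "i \<in> {1..n}" for i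
  proof (cases "i = 1")
    case True
    then show ?thesis using z1 c0 assms(1) by (simp add: newton_den_def zero_power)
  next
    case False
    then show ?thesis
      using newton_den_neg[of d c "z i"] z_ge[of i] that d c0 c1 by fastforce
  qed
  moreover have z2: "z 2 = 1" using zj[of 0] by (simp add: numeral_2_eq_2)
  moreover have "z 3 < 1" using z_step[of 2] z2 assms(2) by (simp add: eval_nat_numeral)
  moreover have "\<forall>i. 3 \<le> i \<and> i < n \<longrightarrow> z (i + 1) < z i" using z_step by simp
  ultimately show ?thesis using zn z1 c0 newton_map_self by simp
qed

end
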